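(* Let $X,Z$ be normed spaces, $\Omega\subset X$, $f:\Omega\to\mathbb{R}$ and $g:\Omega\to Z$ functions, and $U\subset Z$ an open neighborhood of $0_Z$. Let $V:U\rightrightarrows\mathbb{R}$, $V(z):=f\circ g^{-1}(z)=\{f(x):x\in\Omega,\ g(x)=z\}$, and assume $V(z)\ne\varnothing$ for every $z\in U$. Set $$r_0:=\inf\{f(x):x\in\Omega,\ g(x)=0_Z\},$$ and assume $r_0\in\mathbb{R}$. Suppose that the (possibly set-valued) map $V$ is Lipschitzian at $0_Z$, with exact Lipschitzian bound $L_{V,0_Z}$. Then, for any $\mu>L_{V,0_Z}$, $$r_0=\inf\{f(x)+\mu\|g(x)\|:x\in\Omega\}.$$ Moreover, if $r_0=f(x_0)$ for some $x_0\in\Omega$ with $g(x_0)=0_Z$, then $x_0$ also minimizes $f(x)+\mu\|g(x)\|$ over $x\in\Omega$.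
   Context: All normed spaces are real. A set-valued map $H:U\rightrightarrows Y$ is Lipschitzian at $\bar x\in U$ if there is $L\ge0$ with $H(w)\subset H(\bar x)+L\|w-\bar x\|B_Y$ for all $w\in U$, $B_Y$ being the closed unit ball; the infimum of all such $L\ge 0$ is the exact Lipschitzian bound $L_{H,\bar x}$.
   Formalization: The formal statement additionally assumes g(Ω) ⊂ U; without this the claim fails, e.g. for Ω = X = Z = ℝ, g = id, U = (−1,1), f = 0 on U and f = −100 off U, μ = 1. *)

theory Defs
  imports "HOL-Analysis.Analysis"
begin

(* A set-valued map from U to 'b is a function of type 'a => 'b set, of which only the values
   on U matter. *)

definition lipschitz_const_at ::
  "'a::real_normed_vector set \<Rightarrow> ('a \<Rightarrow> 'b::real_normed_vector set) \<Rightarrow> 'a \<Rightarrow> real \<Rightarrow> bool" where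
  "lipschitz_const_at U H x L \<longleftrightarrow>
     0 \<le> L \<and> (\<forall>w\<in>U. H w \<subseteq> {h + (L * norm (w - x)) *\<^sub>R b | h b. h \<in> H x \<and> b \<in> cball 0 1})"

definition lipschitzian_at ::
  "'a::real_normed_vector set \<Rightarrow> ('a \<Rightarrow> 'b::real_normed_vector set) \<Rightarrow> 'a \<Rightarrow> bool" where
  "lipschitzian_at U H x \<longleftrightarrow> x \<in> U \<and> (\<exists>L. lipschitz_const_at U H x L)"

(* Only meaningful if H is Lipschitzian at x: the real infimum of the empty set is arbitrary. *)
definition exact_lipschitz_bound ::
  "'a::real_normed_vector set \<Rightarrow> ('a \<Rightarrow> 'b::real_normed_vector set) \<Rightarrow> 'a \<Rightarrow> real" where
  "exact_lipschitz_bound U H x = Inf {L. lipschitz_const_at U H x L}"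

(* The composition of f with the inverse relation of g. Its graph is {(g x, f x) | x in Om},
   so it is a set-valued map from U to the reals with all values nonempty only if
   g ` Om is contained in U and value_map Om f g z is nonempty for all z in U. *)
definition value_map :: "'x set \<Rightarrow> ('x \<Rightarrow> real) \<Rightarrow> ('x \<Rightarrow> 'z) \<Rightarrow> 'z \<Rightarrow> real set" where
  "value_map Om f g z = {f x | x. x \<in> Om \<and> g x = z}"

end

theory Submission
  imports Defs
begin

text \<open>The penalty is exact because moving the constraint value from \<open>0\<close> to
  \<open>g x\<close> can lower the attainable values of \<open>f\<close> by at most
  \<open>L * norm (g x)\<close>, for any Lipschitz constant \<open>L\<close> at \<open>0\<close>. As
  \<open>g\<close> maps \<open>Om\<close> into \<open>U\<close>, this holds at every point of
  \<open>Om\<close>, not just near the feasible set: \<open>lipschitz_value_map_lower_bound\<close>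
  gives r0 \<le> f x + L * norm (g x). Any \<mu> above the exact bound exceeds some such
  \<open>L\<close> (\<open>lipschitz_const_at_below_exact_bound\<close>), so r0 bounds the penalized
  objective from below. Conversely the penalty vanishes on feasible points, so its infimum is at
  most r0.\<close>

lemma lipschitz_const_at_below_exact_bound:
  assumes "lipschitzian_at U H x" and "exact_lipschitz_bound U H x < \<mu>"
  obtains L where "lipschitz_const_at U H x L" and "L < \<mu>"
proof -
  \<comment> \<open>The real \<open>Inf\<close> is arbitrary on the empty set, so this is what turns
    \<open>Inf\<close> < \<mu> into an actual constant below \<mu>.\<close>
  have "{L. lipschitz_const_at U H x L} \<noteq> {}"
    using assms(1) by (auto simp: lipschitzian_at_def)
  from cInf_lessD[OF this assms(2)[unfolded exact_lipschitz_bound_def]] that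
  show thesis by auto
qed

text \<open>The number \<open>f x\<close> is itself a value of the map at \<open>g x\<close>, so it
  lies within \<open>L * norm (g x)\<close> of some value \<open>h\<close> at \<open>0\<close>, and
  every such \<open>h\<close> is at least \<open>r\<close>.\<close>

lemma lipschitz_value_map_lower_bound:
  fixes g :: "'x \<Rightarrow> 'z::real_normed_vector"
  assumes "lipschitz_const_at U (value_map Om f g) 0 L" and "x \<in> Om" and "g x \<in> U"
    and lower: "\<And>y. y \<in> Om \<Longrightarrow> g y = 0 \<Longrightarrow> r \<le> f y"
  shows "r \<le> f x + L * norm (g x)"
proof -
  have "f x \<in> value_map Om f g (g x)"
    using assms(2) by (auto simp: value_map_def)
  moreover have "0 \<le> L" and "value_map Om f g (g x) \<subseteq>
      {h + (L * norm (g x - 0)) *\<^sub>R b | h b. h \<in> value_map Om f g 0 \<and> b \<in> cball 0 1}"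
    using assms(1,3) unfolding lipschitz_const_at_def by blast+
  ultimately obtain h b where h: "h \<in> value_map Om f g 0" and b: "\<bar>b\<bar> \<le> 1"
    and eq: "f x = h + L * norm (g x) * b"
    by auto
  have "r \<le> h"
    using h lower by (auto simp: value_map_def)
  \<comment> \<open>The worst case is \<open>b = -1\<close>, where \<open>f x\<close> falls below
    \<open>h\<close> by the full Lipschitz radius.\<close>
  moreover have "L * norm (g x) * (- b) \<le> L * norm (g x) * 1"
    using b \<open>0 \<le> L\<close> by (intro mult_left_mono) auto
  ultimately show ?thesis
    using eq by simp
qed

theorem theorem4p17:
  fixes Om :: "'x::real_normed_vector set"
    and f :: "'x \<Rightarrow> real"
    and g :: "'x \<Rightarrow> 'z::real_normed_vector"
    and U :: "'z set"
    and r0 :: real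
  assumes "open U" and "0 \<in> U"
    and g_into_U: "g ` Om \<subseteq> U"
    and "\<forall>z\<in>U. value_map Om f g z \<noteq> {}"
    and "ereal r0 = (INF x\<in>{x \<in> Om. g x = 0}. ereal (f x))"
    and "lipschitzian_at U (value_map Om f g) 0"
  shows "\<forall>\<mu>. \<mu> > exact_lipschitz_bound U (value_map Om f g) 0 \<longrightarrow>
           ereal r0 = (INF x\<in>Om. ereal (f x + \<mu> * norm (g x))) \<and>
           (\<forall>x0\<in>Om. g x0 = 0 \<and> r0 = f x0 \<longrightarrow>
              (\<forall>x\<in>Om. f x0 + \<mu> * norm (g x0) \<le> f x + \<mu> * norm (g x)))"
proof (intro allI impI)
  fix \<mu> :: real
  assume "exact_lipschitz_bound U (value_map Om f g) 0 < \<mu>"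
  with assms(6) obtain L where L: "lipschitz_const_at U (value_map Om f g) 0 L" "L < \<mu>"
    by (rule lipschitz_const_at_below_exact_bound)
  have feasible: "r0 \<le> f y" if "y \<in> Om" "g y = 0" for y
  proof -
    have "ereal r0 \<le> ereal (f y)"
      unfolding assms(5) using that by (intro INF_lower) auto
    then show ?thesis by simp
  qed
  have penalized: "r0 \<le> f x + \<mu> * norm (g x)" if "x \<in> Om" for x
  proof -
    have "r0 \<le> f x + L * norm (g x)"
      using that g_into_U by (intro lipschitz_value_map_lower_bound[OF L(1)] feasible) auto
    also have "\<dots> \<le> f x + \<mu> * norm (g x)"
      using L(2) by (simp add: mult_right_mono)
    finally show ?thesis .
  qed
  \<comment> \<open>Both objectives agree on feasible points, and the left infimum ranges over a
    larger set.\<close>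
  have "(INF x\<in>Om. ereal (f x + \<mu> * norm (g x))) \<le> (INF x\<in>{x \<in> Om. g x = 0}. ereal (f x))"
    by (rule INF_mono) force
  then have "ereal r0 = (INF x\<in>Om. ereal (f x + \<mu> * norm (g x)))"
    using penalized by (intro antisym INF_greatest) (auto simp: assms(5)[symmetric])
  moreover have "\<forall>x0\<in>Om. g x0 = 0 \<and> r0 = f x0 \<longrightarrow>
      (\<forall>x\<in>Om. f x0 + \<mu> * norm (g x0) \<le> f x + \<mu> * norm (g x))"
    using penalized by auto
  ultimately show "ereal r0 = (INF x\<in>Om. ereal (f x + \<mu> * norm (g x))) \<and>
      (\<forall>x0\<in>Om. g x0 = 0 \<and> r0 = f x0 \<longrightarrow>
         (\<forall>x\<in>Om. f x0 + \<mu> * norm (g x0) \<le> f x + \<mu> * norm (g x)))" ..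
qed

end
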